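(* Let $0<\alpha<1$ and $\kappa>1$, and let $\tilde f:[-\pi,\pi]\times[-1,1]\to\mathbb{R}$ be a BMC function such that $\tilde f(\theta,\cdot)$ is continuous on $[-1,1]$ for every $\theta\in[-\pi,\pi]$, and such that for every $\rho\in[-1,1]$ the function $\tilde f(\cdot,\rho)$ extends analytically to the stadium $S_\beta=\{z\in\mathbb{C}:\inf_{x\in[-\pi,\pi]}|x-z|\le\beta\}$ with $\beta=\max(2,1+\alpha^{-1})\,2\pi\kappa$, with these extensions uniformly bounded on $S_\beta$ (uniformly in $\rho$). Let $\tilde f_k$ be the approximant produced after $k$ steps of the BMC structure-preserving Gaussian elimination procedure with coupling parameter $\alpha$ (described below). Then there is a constant $C>0$ such that for all $k\ge0$ $$\|\tilde f-\tilde f_k\|_\infty=\|\tilde e_k\|_\infty\le C\mu^{-k},\qquad \mu=\min\{\kappa,\alpha^{-1}\}.$$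
   Context: A function $\tilde f:[-\pi,\pi]\times[-1,1]\to\mathbb{C}$ is a BMC function if there are $g,h:[0,\pi]\times[0,1]\to\mathbb{C}$ with $\tilde f(\theta,\rho)=g(\theta+\pi,\rho)$ on $[-\pi,0]\times[0,1]$, $\tilde f(\theta,\rho)=h(\theta,\rho)$ on $[0,\pi]\times[0,1]$, $\tilde f(\theta,\rho)=g(\theta,-\rho)$ on $[0,\pi]\times[-1,0]$, $\tilde f(\theta,\rho)=h(\theta+\pi,-\rho)$ on $[-\pi,0]\times[-1,0]$. BMC structure-preserving Gaussian elimination (GE) with coupling parameter $\alpha$: set $\tilde e_0=\tilde f$, $\tilde f_0=0$. For $k=1,2,\dots$: choose $(\theta_k,\rho_k)\in[0,\pi]\times[0,1]$ such that the matrix $M=\begin{bmatrix}a&b\\ b&a\end{bmatrix}$, with $a=\tilde e_{k-1}(\theta_k-\pi,\rho_k)$, $b=\tilde e_{k-1}(\theta_k,\rho_k)$, has maximal largest singular value $\sigma_1(M)=\max\{|a+b|,|a-b|\}$ over all such choices. Define the $2\times2$ matrix $M^{\dagger_\epsilon}=Q\,\mathrm{diag}(m^+,m^-)\,Q^{T}$ with $Q=\tfrac1{\sqrt2}\begin{bmatrix}1&1\\1&-1\end{bmatrix}$ and $(m^+,m^-)=(1/(a+b),0)$ if $|a-b|<\alpha|a+b|$; $(0,1/(a-b))$ if $|a+b|<\alpha|a-b|$; $(1/(a+b),1/(a-b))$ otherwise (this is the $\epsilon$-pseudoinverse of $M$ with $\epsilon=\alpha\sigma_1(M)$; if $M=0$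 the residual is already zero). Then set $$\tilde e_k(\theta,\rho)=\tilde e_{k-1}(\theta,\rho)-\begin{bmatrix}\tilde e_{k-1}(\theta_k-\pi,\rho)&\tilde e_{k-1}(\theta_k,\rho)\end{bmatrix}M^{\dagger_\epsilon}\begin{bmatrix}\tilde e_{k-1}(\theta,\rho_k)\\ \tilde e_{k-1}(\theta,-\rho_k)\end{bmatrix},$$ and let $\tilde f_k=\tilde f-\tilde e_k$ be the accumulated low rank approximant (the sum of the subtracted updates). $\|\cdot\|_\infty$ is the supremum norm on $[-\pi,\pi]\times[-1,1]$. *)

theory Defs
  imports "HOL-Analysis.Analysis"
begin

definition is_BMC :: "(real \<Rightarrow> real \<Rightarrow> real) \<Rightarrow> bool" where
  "is_BMC f \<longleftrightarrow> (\<exists>g h :: real \<Rightarrow> real \<Rightarrow> real.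
     (\<forall>\<theta>\<in>{-pi..0}. \<forall>\<rho>\<in>{0..1}. f \<theta> \<rho> = g (\<theta> + pi) \<rho>) \<and>
     (\<forall>\<theta>\<in>{0..pi}. \<forall>\<rho>\<in>{0..1}. f \<theta> \<rho> = h \<theta> \<rho>) \<and>
     (\<forall>\<theta>\<in>{0..pi}. \<forall>\<rho>\<in>{-1..0}. f \<theta> \<rho> = g \<theta> (-\<rho>)) \<and>
     (\<forall>\<theta>\<in>{-pi..0}. \<forall>\<rho>\<in>{-1..0}. f \<theta> \<rho> = h (\<theta> + pi) (-\<rho>)))"

definition stadium :: "real \<Rightarrow> complex set" where
  "stadium \<beta> = {z. infdist z (complex_of_real ` {-pi..pi}) \<le> \<beta>}"

text \<open>Largest singular value of [[a,b],[b,a]].\<close>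
definition sigma1 :: "real \<Rightarrow> real \<Rightarrow> real" where
  "sigma1 a b = max \<bar>a + b\<bar> \<bar>a - b\<bar>"

text \<open>Eigen-coefficients (m+, m-) of the epsilon-pseudoinverse, eps = alpha * sigma1(M).
  (If M = 0 then, with x/0 = 0, the pseudoinverse is 0 and the update vanishes.)\<close>
definition pinv_coeffs :: "real \<Rightarrow> real \<Rightarrow> real \<Rightarrow> real \<times> real" where
  "pinv_coeffs \<alpha> a b =
     (if \<bar>a - b\<bar> < \<alpha> * \<bar>a + b\<bar> then (1 / (a + b), 0)
      else if \<bar>a + b\<bar> < \<alpha> * \<bar>a - b\<bar> then (0, 1 / (a - b))
      else (1 / (a + b), 1 / (a - b)))"

text \<open>One GE step with pivot (tk, rk):
  e'(t,r) = e(t,r) - [e(tk-pi,r), e(tk,r)] Q diag(m+,m-) Q^T [e(t,rk); e(t,-rk)],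
  with Q = (1/sqrt 2)[[1,1],[1,-1]], written out explicitly.\<close>
definition ge_step :: "real \<Rightarrow> (real \<Rightarrow> real \<Rightarrow> real) \<Rightarrow> real \<Rightarrow> real \<Rightarrow> (real \<Rightarrow> real \<Rightarrow> real)" where
  "ge_step \<alpha> e tk rk = (\<lambda>t r.
     let a = e (tk - pi) rk; b = e tk rk;
         (mp, mm) = pinv_coeffs \<alpha> a b;
         u = e (tk - pi) r; v = e tk r; w = e t rk; z = e t (- rk)
     in e t r - ((u + v) * mp * (w + z) + (u - v) * mm * (w - z)) / 2)"

definition valid_pivot :: "(real \<Rightarrow> real \<Rightarrow> real) \<Rightarrow> real \<Rightarrow> real \<Rightarrow> bool" where
  "valid_pivot e tk rk \<longleftrightarrow> tk \<in> {0..pi} \<and> rk \<in> {0..1} \<and>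
     (\<forall>t\<in>{0..pi}. \<forall>r\<in>{0..1}.
        sigma1 (e (t - pi) r) (e t r) \<le> sigma1 (e (tk - pi) rk) (e tk rk))"

definition bmc_GE_run :: "real \<Rightarrow> (real \<Rightarrow> real \<Rightarrow> real) \<Rightarrow> (nat \<Rightarrow> real \<Rightarrow> real \<Rightarrow> real)
    \<Rightarrow> (nat \<Rightarrow> real) \<Rightarrow> (nat \<Rightarrow> real) \<Rightarrow> bool" where
  "bmc_GE_run \<alpha> f e tp rp \<longleftrightarrow> e 0 = f \<and>
     (\<forall>k. valid_pivot (e k) (tp k) (rp k) \<and> e (Suc k) = ge_step \<alpha> (e k) (tp k) (rp k))"

end

theory Submission
  imports Defs "HOL-Complex_Analysis.Complex_Analysis" "Jordan_Normal_Form.Determinant"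
begin

text \<open>The even and odd parts \<open>e(t,r) \<plusminus> e(t - \<pi>,r)\<close> on \<open>[0,\<pi>] \<times> [0,1]\<close> decouple: each undergoes ordinary
  rank-one elimination at the common pivot, or is left alone when its pivot value is smaller than
  \<open>\<alpha>\<close> times that of the other part. Each part extends analytically and vanishes at its used pivots;
  dividing out these zeros and applying the maximum modulus principle gives it a factor
  \<open>x = 1 / (\<kappa> (1 + 1/\<alpha>))\<close> for every step that updates it alone and a factor \<open>1 / (2 \<kappa>)\<close> for every
  joint step.

  If one part is updated alone more often than the other, this is too weak for the rarely updated
  part. That part is then compared with the other one at the last step updating the latter: there
  the maximum of both residuals is at most \<open>1/\<alpha>\<close> times the pivot of the latter, and afterwards only
  complete pivoting on the former takes place, under which pivots grow subexponentially (Wilkinson: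
  a product of \<open>n\<close> pivots is an \<open>n \<times> n\<close> determinant with entries bounded by the first of them).
  As \<open>(1 + \<alpha>) x = \<alpha>/\<kappa> \<le> \<mu>\<^sup>-\<^sup>2\<close>, the factor \<open>(1 + \<alpha>)\<close> per step is affordable.\<close>

section \<open>Zeros of analytic functions\<close>

text \<open>A Schwarz lemma for several zeros. Dividing out \<open>z - a\<close> divides the bound
  on the frontier, hence on \<open>K\<close>, by \<open>\<beta>\<close>, since the frontier stays
  \<open>\<beta>\<close> away from \<open>I\<close>; multiplying back at a point of \<open>I\<close>
  costs at most \<open>\<delta>\<close>.\<close>

lemma analytic_bound_by_zeros:
  fixes g :: "complex \<Rightarrow> complex" and K I Z :: "complex set"
  assumes "finite Z" "Z \<subseteq> I" "I \<subseteq> K" "compact K" "0 < \<beta>" "0 \<le> \<delta>"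
    and frontier: "\<And>z x. z \<in> frontier K \<Longrightarrow> x \<in> I \<Longrightarrow> \<beta> \<le> cmod (z - x)"
    and diam: "\<And>x y. x \<in> I \<Longrightarrow> y \<in> I \<Longrightarrow> cmod (x - y) \<le> \<delta>"
    and "g analytic_on K" "\<And>z. z \<in> K \<Longrightarrow> cmod (g z) \<le> B"
    and "\<And>z. z \<in> Z \<Longrightarrow> g z = 0" "x \<in> I"
  shows "cmod (g x) \<le> B * (\<delta> / \<beta>) ^ card Z"
  using assms(1,2,9-)
proof (induction Z arbitrary: g B x rule: finite_induct)
  case empty
  then show ?case using \<open>I \<subseteq> K\<close> by auto
next
  case (insert a Z)
  from \<open>g analytic_on K\<close> obtain U where U: "open U" "K \<subseteq> U" "g holomorphic_on U"
    unfolding analytic_on_holomorphic by blast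
  \<comment> \<open>The value \<open>deriv g a\<close> removes the singularity. The quotient still
    vanishes on the rest of the zeros, so the induction hypothesis applies to it with
    \<open>B / \<beta>\<close>.\<close>
  define h where "h = (\<lambda>z. if z = a then deriv g a else (g z - g a) / (z - a))"
  have h_U: "h holomorphic_on U"
    unfolding h_def by (rule pole_lemma_open) fact+
  have ga: "g a = 0" using insert.prems by simp
  have g_h: "g z = (z - a) * h z" for z
    using ga by (auto simp: h_def)
  have aI: "a \<in> I" using insert.prems by simp
  have h_K: "cmod (h z) \<le> B / \<beta>" if "z \<in> K" for z
  proof (rule maximum_modulus_frontier[of h K])
    show "h holomorphic_on interior K"
      using h_U U(2) interior_subset by (meson holomorphic_on_subset subset_trans)
    show "continuous_on (closure K) h"
      using h_U U(2) \<open>compact K\<close>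
      by (metis closure_eq compact_imp_closed continuous_on_subset holomorphic_on_imp_continuous_on)
    show "bounded K" using \<open>compact K\<close> by (rule compact_imp_bounded)
    show "z \<in> K" by fact
    show "cmod (h w) \<le> B / \<beta>" if w: "w \<in> frontier K" for w
    proof -
      have "w \<in> K" using w \<open>compact K\<close> by (simp add: compact_imp_closed frontier_def)
      have "\<beta> * cmod (h w) \<le> cmod (w - a) * cmod (h w)"
        by (intro mult_right_mono frontier w aI) simp
      also have "\<dots> = cmod (g w)" by (simp add: g_h norm_mult)
      also have "\<dots> \<le> B" using insert.prems \<open>w \<in> K\<close> by blast
      finally show ?thesis using \<open>0 < \<beta>\<close> by (simp add: field_simps)
    qed
  qed
  have "cmod (h x) \<le> B / \<beta> * (\<delta> / \<beta>) ^ card Z"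
  proof (rule insert.IH[where g = h])
    show "h analytic_on K" using U h_U analytic_on_holomorphic by blast
    show "h z = 0" if "z \<in> Z" for z
      using that insert.hyps insert.prems ga by (auto simp: h_def)
  qed (use insert.prems h_K in auto)
  then have "cmod (x - a) * cmod (h x) \<le> \<delta> * (B / \<beta> * (\<delta> / \<beta>) ^ card Z)"
    by (intro mult_mono diam) (use insert.prems \<open>0 \<le> \<delta>\<close> in auto)
  then show ?case
    using insert.hyps by (simp add: g_h norm_mult mult_ac)
qed

section \<open>Pivot growth\<close>

text \<open>A constant below 1 is what matters: the quarter left over pays for the factorial in
  \<open>subexponential_growth\<close>. AM-GM around \<open>sqrt j\<close> yields 3/4.\<close>

lemma sum_sqrt_le: "(\<Sum>i<j. sqrt (real i)) \<le> 3 / 4 * real j * sqrt (real j)"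
proof (cases "j = 0")
  case False
  define s where "s = sqrt (real j)"
  have s: "s > 0" "s * s = real j" using False by (auto simp: s_def)
  have am_gm: "sqrt (real i) \<le> (real i / s + s) / 2" for i
  proof -
    have "0 \<le> (sqrt (real i) - s)\<^sup>2" by simp
    then have "2 * sqrt (real i) * s \<le> real i + s * s" by (simp add: power2_diff power2_eq_square[of s] mult_ac)
    then show ?thesis using s by (simp add: field_simps)
  qed
  have "2 * (\<Sum>i<j. real i) \<le> real j * real j"
    by (induction j) (auto simp: algebra_simps)
  then have sum: "(\<Sum>i<j. real i) \<le> real j * real j / 2" by simp
  have "(\<Sum>i<j. sqrt (real i)) \<le> (\<Sum>i<j. (real i / s + s) / 2)"
    by (intro sum_mono am_gm)
  also have "\<dots> = ((\<Sum>i<j. real i) / s + real j * s) / 2"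
    by (simp add: sum.distrib sum_divide_distrib[symmetric])
  also have "\<dots> \<le> (real j * real j / 2 / s + real j * s) / 2"
    using sum s by (simp add: divide_right_mono)
  also have "\<dots> = 3 / 4 * real j * s"
    using s(1) by (simp add: field_simps flip: s(2))
  finally show ?thesis by (simp add: s_def)
qed simp

text \<open>Crude on purpose: the factorial only has to fit into the order
  \<open>j * sqrt j\<close>, for which \<open>n! \<le> n ^ n\<close> suffices.\<close>

lemma ln_fact_le: "j > 0 \<Longrightarrow> ln (fact (Suc j)) \<le> 4 * real j * sqrt (real j)"
proof -
  assume j: "j > 0"
  have "sqrt (real (Suc j)) \<le> sqrt (real j) + 1"
    using sqrt_add_le_add_sqrt[of "real j" 1] by (simp add: add.commute)
  moreover have "ln (sqrt (real (Suc j))) \<le> sqrt (real (Suc j)) - 1"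
    by (intro ln_le_minus_one) simp
  moreover have "ln (sqrt (real (Suc j))) = ln (real (Suc j)) / 2"
    by (simp add: ln_sqrt)
  ultimately have ln: "ln (real (Suc j)) \<le> 2 * sqrt (real j)" by linarith
  have "(fact (Suc j) :: real) \<le> real (Suc j) ^ Suc j"
    using fact_le_power[of "Suc j", where 'a = real] by (simp only: of_nat_power)
  then have "ln (fact (Suc j) :: real) \<le> ln (real (Suc j) ^ Suc j)"
    by (intro ln_mono) (simp_all del: fact_Suc power_Suc)
  also have "\<dots> = real (Suc j) * ln (real (Suc j))" by (rule ln_realpow)
  also have "\<dots> \<le> (2 * real j) * (2 * sqrt (real j))"
    using j by (intro mult_mono ln) auto
  finally show ?thesis by simp
qed

text \<open>Applied with the pivots in reverse order, so that \<open>y 0\<close> is the last one.\<close>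

lemma subexponential_growth:
  fixes y :: "nat \<Rightarrow> real"
  assumes pos: "\<And>j. j \<le> m \<Longrightarrow> 0 < y j"
    and prod: "\<And>j. j \<le> m \<Longrightarrow> (\<Prod>i\<le>j. y i) \<le> fact (Suc j) * y j ^ Suc j"
  shows "y 0 \<le> exp (16 * sqrt (real m)) * y m"
proof -
  have "ln (y 0) \<le> 16 * sqrt (real j) + ln (y j)" if "j \<le> m" for j
    using that
  proof (induction j rule: less_induct)
    case (less j)
    show ?case
    proof (cases "j = 0")
      case False
      have pos_j: "0 < y i" if "i \<le> j" for i using pos that less.prems by simp
      have "(\<Sum>i\<le>j. ln (y i)) = ln (\<Prod>i\<le>j. y i)"
        using pos_j by (intro ln_prod[symmetric]) force+
      also have "\<dots> \<le> ln (fact (Suc j) * y j ^ Suc j)"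
        using prod[OF less.prems] less.prems
        by (subst ln_le_cancel_iff)
          (auto intro!: prod_pos mult_pos_pos pos zero_less_power simp del: fact_Suc power_Suc)
      also have "\<dots> = ln (fact (Suc j)) + real (Suc j) * ln (y j)"
        using pos[OF less.prems]
        by (subst ln_mult_pos) (auto simp del: fact_Suc power_Suc simp: ln_realpow)
      finally have *: "(\<Sum>i<j. ln (y i)) \<le> ln (fact (Suc j)) + real j * ln (y j)"
        by (simp add: lessThan_Suc_atMost[symmetric] algebra_simps del: fact_Suc)
      \<comment> \<open>The induction hypotheses are summed over all \<open>i < j\<close>, so that
        \<open>*\<close> applies to the sum of logarithms. The constant 16 is chosen to reproduce
        itself: 16 * 3/4 + 4 = 16.\<close>
      have "real j * ln (y 0) = (\<Sum>i<j. ln (y 0))" by simp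
      also have "\<dots> \<le> (\<Sum>i<j. 16 * sqrt (real i) + ln (y i))"
        using less.prems by (intro sum_mono less.IH) auto
      also have "\<dots> = 16 * (\<Sum>i<j. sqrt (real i)) + (\<Sum>i<j. ln (y i))"
        by (simp add: sum.distrib sum_distrib_left)
      also have "\<dots> \<le> 16 * (3 / 4 * real j * sqrt (real j))
          + (4 * real j * sqrt (real j) + real j * ln (y j))"
        using sum_sqrt_le[of j] ln_fact_le[of j] * False by linarith
      also have "\<dots> = real j * (16 * sqrt (real j) + ln (y j))" by (simp add: algebra_simps)
      finally show ?thesis using False by simp
    qed simp
  qed
  from this[of m] have "exp (ln (y 0)) \<le> exp (16 * sqrt (real m) + ln (y m))" by simp
  then show ?thesis using pos[of 0] pos[of m] by (simp add: exp_add)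
qed

text \<open>Completing the square, with 64 = 8 * 8 and 16 = 2 * 8. Subexponential growth is thereby
  traded for a constant and a geometric rate as close to 1 as desired.\<close>

lemma exp_sqrt_le_power:
  assumes "1 < (l::real)"
  shows "exp (16 * sqrt (real m)) \<le> exp (64 / ln l) * l ^ m"
proof -
  define L where "L = ln l"
  have L: "L > 0" using assms by (simp add: L_def)
  have "0 \<le> (L * sqrt (real m) - 8)\<^sup>2" by simp
  then have "16 * sqrt (real m) * L \<le> L * L * real m + 64"
    by (simp add: power2_diff power_mult_distrib power2_eq_square algebra_simps)
  then have "16 * sqrt (real m) \<le> 64 / L + real m * L"
    using L by (simp add: field_simps)
  then have "exp (16 * sqrt (real m)) \<le> exp (64 / L) * exp (real m * L)"
    by (simp flip: exp_add)
  also have "exp (real m * L) = l ^ m"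
    using assms by (simp add: L_def exp_of_nat_mult)
  finally show ?thesis by (simp add: L_def)
qed

text \<open>The Leibniz expansion has \<open>n!\<close> terms. Hadamard's inequality would be
  sharper, but the growth derived from this bound is subexponential already.\<close>

lemma abs_det_le:
  fixes M :: "real mat"
  assumes M: "M \<in> carrier_mat n n"
    and le: "\<And>i j. i < n \<Longrightarrow> j < n \<Longrightarrow> \<bar>M $$ (i, j)\<bar> \<le> c"
  shows "\<bar>Determinant.det M\<bar> \<le> fact n * c ^ n"
proof -
  have summand: "\<bar>signof p * (\<Prod>i = 0..<n. M $$ (i, p i))\<bar> \<le> c ^ n" if "p permutes {0..<n}" for p
  proof -
    have "(\<Prod>i = 0..<n. \<bar>M $$ (i, p i)\<bar>) \<le> (\<Prod>i = 0..<n. c)"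
      using that by (intro prod_mono conjI le) (auto dest: permutes_in_image)
    then show ?thesis by (simp add: abs_mult abs_prod sign_def)
  qed
  have "\<bar>Determinant.det M\<bar> \<le> (\<Sum>p | p permutes {0..<n}. \<bar>signof p * (\<Prod>i = 0..<n. M $$ (i, p i))\<bar>)"
    unfolding det_def'[OF M] by (rule sum_abs)
  also have "\<dots> \<le> of_nat (card {p. p permutes {0..<n}}) * c ^ n"
    by (intro sum_bounded_above summand) simp
  also have "card {p. p permutes {0..<n}} = fact n"
    by (simp add: card_permutations)
  finally show ?thesis by simp
qed

section \<open>Scalar elimination\<close>

text \<open>Gaussian elimination with prescribed pivots. They are only required to be non-zero at
  active steps, because a pivot shared with a second elimination need not be maximal for this one;
  maximality enters as a hypothesis of the lemmas that use it.\<close>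

locale cross_elimination =
  fixes u :: "nat \<Rightarrow> real \<Rightarrow> real \<Rightarrow> real" and T Y :: "real set"
    and tp rp :: "nat \<Rightarrow> real" and active :: "nat \<Rightarrow> bool"
  assumes tp: "tp k \<in> T" and rp: "rp k \<in> Y"
    and pivot: "active k \<Longrightarrow> u k (tp k) (rp k) \<noteq> 0"
    and update: "active k \<Longrightarrow> t \<in> T \<Longrightarrow> r \<in> Y \<Longrightarrow>
      u (Suc k) t r = u k t r - u k (tp k) r * u k t (rp k) / u k (tp k) (rp k)"
    and idle: "\<not> active k \<Longrightarrow> t \<in> T \<Longrightarrow> r \<in> Y \<Longrightarrow> u (Suc k) t r = u k t r"
begin

text \<open>An update annihilates the column of its pivot. Later updates preserve this, as what they
  subtract there carries the factor \<open>u k (tp i) (rp k) = 0\<close>.\<close>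

lemma zero_column:
  assumes "active i" "i < k" "r \<in> Y"
  shows "u k (tp i) r = 0"
  using assms(2,3)
proof (induction k arbitrary: r)
  case (Suc k)
  show ?case
  proof (cases "i = k")
    case True
    then show ?thesis using Suc.prems update[of k "tp k" r] pivot[of k] tp \<open>active i\<close> by auto
  next
    case False
    then show ?thesis
      using Suc update[of k "tp i" r] idle[of k "tp i" r] tp rp by (cases "active k") auto
  qed
qed simp

text \<open>A repeated abscissa would place the later pivot in an annihilated column. Hence every
  active step contributes a new zero in \<open>decay\<close>.\<close>

lemma inj_on_pivots: "inj_on tp {i. active i}"
proof (rule inj_onI)
  fix i j assume *: "i \<in> {i. active i}" "j \<in> {i. active i}" "tp i = tp j"
  have False if "i < j" "active i" "active j" "tp i = tp j" for i j
    using zero_column[of i j "rp j"] pivot[of j] rp that by auto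
  then show "i = j" using * by (metis linorder_neqE_nat mem_Collect_eq)
qed

text \<open>Elimination is an LU factorisation: the samples of \<open>u s\<close> at the pivot
  positions form a matrix whose determinant is the product of the pivots and whose entries are
  bounded by \<open>c\<close>.\<close>

lemma prod_pivots_le:
  assumes act: "\<And>i. i < n \<Longrightarrow> active (s + i)"
    and le: "\<And>t r. t \<in> T \<Longrightarrow> r \<in> Y \<Longrightarrow> \<bar>u s t r\<bar> \<le> c"
  shows "(\<Prod>i<n. \<bar>u (s + i) (tp (s + i)) (rp (s + i))\<bar>) \<le> fact n * c ^ n"
proof -
  define q where "q i = u (s + i) (tp (s + i)) (rp (s + i))" for i
  define L where "L = mat n n (\<lambda>(a, i). u (s + i) (tp (s + a)) (rp (s + i)))"
  define U where "U = mat n n (\<lambda>(i, b). u (s + i) (tp (s + i)) (rp (s + b)) / q i)"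
  define M where "M = mat n n (\<lambda>(a, b). u s (tp (s + a)) (rp (s + b)))"
  have carrier: "L \<in> carrier_mat n n" "U \<in> carrier_mat n n" "M \<in> carrier_mat n n"
    by (auto simp: L_def U_def M_def)
  have q: "q i \<noteq> 0" if "i < n" for i
    using pivot act that by (auto simp: q_def)
  have zero_row: "u k t (rp i) = 0" if "active i" "i < k" "t \<in> T" for i k t
    using that(2,3)
  proof (induction k arbitrary: t)
    case (Suc k)
    show ?case
    proof (cases "i = k")
      case True
      then show ?thesis using Suc.prems update[of k t "rp k"] pivot[of k] rp \<open>active i\<close> by auto
    next
      case False
      then show ?thesis
        using Suc update[of k t "rp i"] idle[of k t "rp i"] tp rp by (cases "active k") auto
    qed
  qed simp
  \<comment> \<open>The updates add up to rank-one terms, columns of \<open>L\<close> times rows of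
    \<open>U\<close>; dividing by the pivot in \<open>U\<close> leaves the pivots on the diagonal of
    \<open>L\<close>. For \<open>m = n\<close> the remainder vanishes in the sampled columns by
    \<open>zero_column\<close>.\<close>
  have telescope: "u s t r = (\<Sum>i<m. u (s + i) t (rp (s + i)) * (u (s + i) (tp (s + i)) r / q i)) + u (s + m) t r"
    if "m \<le> n" "t \<in> T" "r \<in> Y" for m t r
    using that(1)
  proof (induction m)
    case (Suc m)
    then show ?case
      using update[of "s + m" t r] act[of m] that by (simp add: q_def mult.commute)
  qed simp
  have "M = L * U"
  proof (rule eq_matI)
    fix a b assume "a < dim_row (L * U)" "b < dim_col (L * U)"
    then have ab: "a < n" "b < n" using carrier by auto
    have "M $$ (a, b) = (\<Sum>i<n. L $$ (a, i) * U $$ (i, b))"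
      using telescope[of n "tp (s + a)" "rp (s + b)"] zero_column[of "s + a" "s + n" "rp (s + b)"]
        ab act tp rp
      by (simp add: M_def L_def U_def)
    also have "\<dots> = (L * U) $$ (a, b)"
      using ab carrier by (simp add: times_mat_def scalar_prod_def lessThan_atLeast0)
    finally show "M $$ (a, b) = (L * U) $$ (a, b)" .
  qed (use carrier in auto)
  then have "Determinant.det M = Determinant.det L * Determinant.det U"
    using carrier by (simp add: det_mult)
  also have "Determinant.det L = (\<Prod>i<n. q i)"
  proof (subst det_lower_triangular[OF _ carrier(1)])
    show "L $$ (i, j) = 0" if "i < j" "j < n" for i j
      using that zero_column[of "s + i" "s + j" "rp (s + j)"] act rp by (simp add: L_def)
    show "prod_list (diag_mat L) = (\<Prod>i<n. q i)"
      using carrier by (simp add: prod_list_diag_prod lessThan_atLeast0 L_def q_def)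
  qed
  also have "Determinant.det U = 1"
  proof (subst det_upper_triangular[OF _ carrier(2)])
    show "upper_triangular U"
      using zero_row tp act carrier by (auto simp: upper_triangular_def U_def)
    show "prod_list (diag_mat U) = 1"
      using carrier q by (simp add: prod_list_diag_prod U_def flip: q_def)
  qed
  finally have "(\<Prod>i<n. \<bar>q i\<bar>) = \<bar>Determinant.det M\<bar>" by (simp add: abs_prod)
  also have "\<dots> \<le> fact n * c ^ n"
    by (rule abs_det_le[OF carrier(3)]) (auto simp: M_def intro!: le tp rp)
  finally show ?thesis by (simp add: q_def)
qed

text \<open>\<open>prod_pivots_le\<close> applies to every tail of the run, since complete pivoting
  makes the first pivot of a tail a bound for all entries at that stage. Read backwards, the pivots
  satisfy the hypotheses of \<open>subexponential_growth\<close>.\<close>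

lemma growth_complete_pivoting:
  assumes l: "1 < (l::real)"
    and act: "\<And>i. i \<le> n \<Longrightarrow> active (s + i)"
    and complete: "\<And>i t r. i \<le> n \<Longrightarrow> t \<in> T \<Longrightarrow> r \<in> Y \<Longrightarrow>
      \<bar>u (s + i) t r\<bar> \<le> \<bar>u (s + i) (tp (s + i)) (rp (s + i))\<bar>"
  shows "\<bar>u (s + n) (tp (s + n)) (rp (s + n))\<bar> \<le> exp (64 / ln l) * l ^ n * \<bar>u s (tp s) (rp s)\<bar>"
proof -
  define q where "q i = \<bar>u (s + i) (tp (s + i)) (rp (s + i))\<bar>" for i
  have "q (n - 0) \<le> exp (16 * sqrt (real n)) * q (n - n)"
  proof (rule subexponential_growth[where y = "\<lambda>j. q (n - j)"])
    show "0 < q (n - j)" for j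
      using pivot act[of "n - j"] by (auto simp: q_def)
    show "(\<Prod>i\<le>j. q (n - i)) \<le> fact (Suc j) * q (n - j) ^ Suc j" if j: "j \<le> n" for j
    proof -
      have "(\<Prod>i\<le>j. q (n - i)) = (\<Prod>i<Suc j. q (n - j + i))"
        using j by (intro prod.reindex_bij_witness[of _ "\<lambda>i. j - i" "\<lambda>i. j - i"]) auto
      also have "\<dots> = (\<Prod>i<Suc j. \<bar>u (n - j + s + i) (tp (n - j + s + i)) (rp (n - j + s + i))\<bar>)"
        by (simp add: q_def add_ac)
      also have "\<dots> \<le> fact (Suc j) * q (n - j) ^ Suc j"
      proof (rule prod_pivots_le)
        show "active (n - j + s + i)" if "i < Suc j" for i
          using act[of "n - j + i"] that j by (simp add: add_ac)
        show "\<bar>u (n - j + s) t r\<bar> \<le> q (n - j)" if "t \<in> T" "r \<in> Y" for t r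
          using complete[of "n - j" t r] that by (simp add: q_def add_ac)
      qed
      finally show ?thesis .
    qed
  qed
  also have "\<dots> \<le> exp (64 / ln l) * l ^ n * q (n - n)"
    by (intro mult_right_mono exp_sqrt_le_power l) (simp add: q_def)
  finally show ?thesis by (simp add: q_def)
qed

text \<open>Two effects compete at an active step: the bound of the analytic extension on
  \<open>K\<close> grows by \<open>1 + c i\<close>, where \<open>c i\<close> bounds the ratio of
  entries to the pivot, and a new zero at \<open>tp i\<close> gains
  \<open>\<delta> / \<beta>\<close> by \<open>analytic_bound_by_zeros\<close>.\<close>

lemma decay:
  fixes G :: "real \<Rightarrow> complex \<Rightarrow> complex" and c :: "nat \<Rightarrow> real"
  assumes K: "compact K" "of_real ` T \<subseteq> K" and "0 < \<beta>" "0 \<le> \<delta>"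
    and frontier: "\<And>z t. z \<in> frontier K \<Longrightarrow> t \<in> T \<Longrightarrow> \<beta> \<le> cmod (z - of_real t)"
    and diam: "\<And>s t. s \<in> T \<Longrightarrow> t \<in> T \<Longrightarrow> \<bar>s - t\<bar> \<le> \<delta>"
    and analytic: "\<And>r. r \<in> Y \<Longrightarrow> G r analytic_on K"
    and extends: "\<And>r t. r \<in> Y \<Longrightarrow> t \<in> T \<Longrightarrow> G r (of_real t) = of_real (u 0 t r)"
    and bound: "\<And>r z. r \<in> Y \<Longrightarrow> z \<in> K \<Longrightarrow> cmod (G r z) \<le> B"
    and c: "\<And>i t r. active i \<Longrightarrow> t \<in> T \<Longrightarrow> r \<in> Y \<Longrightarrow> \<bar>u i t r\<bar> \<le> c i * \<bar>u i (tp i) (rp i)\<bar>"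
    and tr: "t \<in> T" "r \<in> Y"
  shows "\<bar>u k t r\<bar> \<le> B * (\<Prod>i | i < k \<and> active i. (1 + c i) * (\<delta> / \<beta>))"
proof -
  define D where "D k = (\<Prod>i | i < k \<and> active i. 1 + c i)" for k
  have D_Suc: "D (Suc k) = (if active k then (1 + c k) * D k else D k)" for k
  proof -
    have "{i. i < Suc k \<and> active i} = (if active k then insert k {i. i < k \<and> active i}
        else {i. i < k \<and> active i})"
      by (auto simp: less_Suc_eq)
    then show ?thesis by (auto simp: D_def)
  qed
  \<comment> \<open>All slices are carried along at once, because updating slice \<open>r\<close>
    subtracts a multiple of slice \<open>rp k\<close>. The multiplier does not depend on the
    analytic variable.\<close>
  have "\<exists>H. (\<forall>r\<in>Y. H r analytic_on K \<and> (\<forall>t\<in>T. H r (of_real t) = complex_of_real (u k t r)) \<and>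
      (\<forall>z\<in>K. cmod (H r z) \<le> B * D k))"
  proof (induction k)
    case 0
    then show ?case using analytic extends bound by (intro exI[of _ G]) (auto simp: D_def)
  next
    case (Suc k)
    then obtain H where H: "\<And>r. r \<in> Y \<Longrightarrow> H r analytic_on K"
      "\<And>r t. r \<in> Y \<Longrightarrow> t \<in> T \<Longrightarrow> H r (of_real t) = complex_of_real (u k t r)"
      "\<And>r z. r \<in> Y \<Longrightarrow> z \<in> K \<Longrightarrow> cmod (H r z) \<le> B * D k"
      by metis
    show ?case
    proof (cases "active k")
      case False
      then show ?thesis using H idle by (intro exI[of _ H]) (auto simp: D_Suc)
    next
      case True
      define w where "w r = u k (tp k) r / u k (tp k) (rp k)" for r
      have w: "\<bar>w r\<bar> \<le> c k" if "r \<in> Y" for r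
        using c[OF True tp that] pivot[OF True] by (simp add: w_def field_simps abs_divide)
      define H' where "H' r z = H r z - of_real (w r) * H (rp k) z" for r z
      show ?thesis
      proof (intro exI[of _ H'] ballI conjI)
        fix r assume r: "r \<in> Y"
        show "H' r analytic_on K"
          unfolding H'_def using H(1)[OF r] H(1)[OF rp]
          by (intro analytic_on_diff analytic_on_mult analytic_on_const)
        show "H' r (of_real t) = complex_of_real (u (Suc k) t r)" if "t \<in> T" for t
          using that r H(2) rp update[OF True that r] by (simp add: H'_def w_def)
        show "cmod (H' r z) \<le> B * D (Suc k)" if z: "z \<in> K" for z
        proof -
          have "cmod (H' r z) \<le> cmod (H r z) + \<bar>w r\<bar> * cmod (H (rp k) z)"
            unfolding H'_def by (rule norm_triangle_le_diff) (simp add: norm_mult)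
          also have "\<dots> \<le> B * D k + c k * (B * D k)"
            using w[OF r] H(3)[OF r z] H(3)[OF rp z]
            by (intro add_mono mult_mono) auto
          also have "\<dots> = B * D (Suc k)" using True by (simp add: D_Suc algebra_simps)
          finally show ?thesis .
        qed
      qed
    qed
  qed
  then obtain H where H: "H analytic_on K" "\<And>t. t \<in> T \<Longrightarrow> H (of_real t) = complex_of_real (u k t r)"
    "\<And>z. z \<in> K \<Longrightarrow> cmod (H z) \<le> B * D k"
    using tr by metis
  let ?A = "{i. i < k \<and> active i}"
  have "inj_on tp ?A" using inj_on_pivots by (rule inj_on_subset) auto
  then have card: "card ((\<lambda>i. complex_of_real (tp i)) ` ?A) = card ?A"
    by (intro card_image) (auto simp: inj_on_def)
  have "cmod (H (of_real t)) \<le> B * D k * (\<delta> / \<beta>) ^ card ((\<lambda>i. complex_of_real (tp i)) ` ?A)"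
  proof (rule analytic_bound_by_zeros[where g = H and I = "of_real ` T" and K = K])
    show "cmod (x - y) \<le> \<delta>" if xy: "x \<in> of_real ` T" "y \<in> of_real ` T" for x y
    proof -
      obtain s t where "s \<in> T" "t \<in> T" "x = of_real s" "y = of_real t" using xy by blast
      then show ?thesis using diam by (simp flip: of_real_diff)
    qed
    show "H z = 0" if "z \<in> (\<lambda>i. complex_of_real (tp i)) ` ?A" for z
      using that H(2) tp zero_column tr by auto
  qed (use K \<open>0 < \<beta>\<close> \<open>0 \<le> \<delta>\<close> frontier H tp tr in auto)
  then show ?thesis
    using H(2) tr by (simp add: card D_def prod.distrib mult.assoc del: times_divide_eq_right)
qed

end

section \<open>Balancing two coupled eliminations\<close>

text \<open>\<open>A\<close> and \<open>B\<close> tell which parts a step updates. If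
  \<open>b k \<le> a k\<close>, then \<open>k \<le> 2 * a k + c k\<close>, and
  \<open>x \<le> y\<^sup>2\<close> lets each lone step of \<open>A\<close> pay for two; the same
  works for \<open>B\<close> if \<open>B k\<close> holds and \<open>b k\<close> is the larger count.
  Otherwise the bound for \<open>B\<close> is taken at its last update \<open>j\<close>. The lone
  run of \<open>A\<close> after it is no longer than \<open>a k < b k\<close>, so its growth is
  absorbed into \<open>(l * x) ^ b k\<close>.\<close>

lemma coupled_rate_aux:
  fixes \<sigma> :: "nat \<Rightarrow> real" and A B :: "nat \<Rightarrow> bool"
  defines "a \<equiv> \<lambda>k. card {i. i < k \<and> A i \<and> \<not> B i}"
    and "b \<equiv> \<lambda>k. card {i. i < k \<and> B i \<and> \<not> A i}"
    and "c \<equiv> \<lambda>k. card {i. i < k \<and> A i \<and> B i}"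
  assumes x: "0 < x" "x \<le> 1" and y: "0 < y" "y \<le> 1" and l: "1 \<le> l" "l * x \<le> y\<^sup>2"
    and nonneg: "0 \<le> C" "0 \<le> W" "0 \<le> g"
    and boundA: "\<And>k. A k \<Longrightarrow> \<sigma> k \<le> C * x ^ a k * y ^ c k"
    and boundB: "\<And>k. B k \<Longrightarrow> \<sigma> k \<le> C * x ^ b k * y ^ c k"
    and runA: "\<And>j n. (\<And>i. i \<le> n \<Longrightarrow> A (j + i) \<and> \<not> B (j + i)) \<Longrightarrow> \<sigma> (j + n) \<le> W * l ^ n * \<sigma> j"
    and growth: "\<And>i. \<sigma> (Suc i) \<le> g * \<sigma> i"
    and some: "\<And>i. i < k \<Longrightarrow> A i \<or> B i" and "A k"
  shows "\<sigma> k \<le> (C + W * g * C / (x * y)) * y ^ k"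
proof -
  have a_Suc: "a (Suc k) = (if A k \<and> \<not> B k then Suc (a k) else a k)" for k
  proof -
    have "{i. i < Suc k \<and> A i \<and> \<not> B i} =
        (if A k \<and> \<not> B k then insert k {i. i < k \<and> A i \<and> \<not> B i} else {i. i < k \<and> A i \<and> \<not> B i})"
      by (auto simp: less_Suc_eq)
    then show ?thesis by (simp add: a_def)
  qed
  have b_Suc: "b (Suc k) = (if B k \<and> \<not> A k then Suc (b k) else b k)" for k
  proof -
    have "{i. i < Suc k \<and> B i \<and> \<not> A i} =
        (if B k \<and> \<not> A k then insert k {i. i < k \<and> B i \<and> \<not> A i} else {i. i < k \<and> B i \<and> \<not> A i})"
      by (auto simp: less_Suc_eq)
    then show ?thesis by (simp add: b_def)
  qed
  have c_Suc: "c (Suc k) = (if A k \<and> B k then Suc (c k) else c k)" for k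
  proof -
    have "{i. i < Suc k \<and> A i \<and> B i} =
        (if A k \<and> B k then insert k {i. i < k \<and> A i \<and> B i} else {i. i < k \<and> A i \<and> B i})"
      by (auto simp: less_Suc_eq)
    then show ?thesis by (simp add: c_def)
  qed
  have "n \<le> k \<Longrightarrow> a n + b n + c n = n" for n
  proof (induction n)
    case 0
    then show ?case by (simp add: a_def b_def c_def)
  next
    case (Suc n)
    then show ?case using some[of n] by (auto simp: a_Suc b_Suc c_Suc)
  qed
  then have total: "a k + b k + c k = k" by simp
  have "x \<le> y\<^sup>2"
    using mult_right_mono[of 1 l x] l x by linarith
  \<comment> \<open>Used with \<open>z = x\<close> in the two direct cases and
    \<open>z = l * x\<close> in the third; \<open>n\<close> is the larger of the two lone
    counts.\<close>
  have rate: "z ^ n * y ^ c k \<le> y ^ k" if "0 \<le> z" "z \<le> y\<^sup>2" "k \<le> 2 * n + c k" for z n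
  proof -
    have "z ^ n \<le> (y\<^sup>2) ^ n" using that by (intro power_mono)
    then have "z ^ n * y ^ c k \<le> (y\<^sup>2) ^ n * y ^ c k"
      using y by (intro mult_right_mono) auto
    also have "\<dots> = y ^ (2 * n + c k)" by (simp add: power_add power_mult)
    also have "\<dots> \<le> y ^ k" using y that by (intro power_decreasing) auto
    finally show ?thesis .
  qed
  have summand: "C * y ^ k \<le> (C + W * g * C / (x * y)) * y ^ k"
    "W * g * C / (x * y) * y ^ k \<le> (C + W * g * C / (x * y)) * y ^ k"
    using x y nonneg by (simp_all add: distrib_right)
  consider "b k \<le> a k" | "a k < b k" "B k" | "a k < b k" "\<not> B k" by linarith
  then show ?thesis
  proof cases
    case 1
    have "\<sigma> k \<le> C * (x ^ a k * y ^ c k)" using boundA[OF \<open>A k\<close>] by (simp add: mult.assoc)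
    also have "\<dots> \<le> C * y ^ k"
      using 1 total x \<open>x \<le> y\<^sup>2\<close> nonneg by (intro mult_left_mono rate) auto
    finally show ?thesis using summand by linarith
  next
    case 2
    have "\<sigma> k \<le> C * (x ^ b k * y ^ c k)" using boundB[OF \<open>B k\<close>] by (simp add: mult.assoc)
    also have "\<dots> \<le> C * y ^ k"
      using 2 total x \<open>x \<le> y\<^sup>2\<close> nonneg by (intro mult_left_mono rate) auto
    finally show ?thesis using summand by linarith
  next
    case 3
    define j where "j = Max {j. j < k \<and> B j}"
    have "{i. i < k \<and> B i \<and> \<not> A i} \<noteq> {}" using 3(1) unfolding b_def by (metis card.empty not_less_zero)
    then have "{j. j < k \<and> B j} \<noteq> {}" by blast
    then have "j \<in> {j. j < k \<and> B j}" unfolding j_def by (intro Max_in) auto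
    then have j: "j < k" "B j" by auto
    have after: "\<not> B i" if "j < i" "i \<le> k" for i
    proof
      assume "B i"
      then have "i < k" using 3(2) that le_neq_implies_less by blast
      then have "i \<le> j" unfolding j_def using \<open>B i\<close> by (intro Max_ge) auto
      then show False using that by simp
    qed
    define n where "n = k - Suc j"
    have k: "k = Suc j + n" using j by (simp add: n_def)
    have only: "A (Suc j + i) \<and> \<not> B (Suc j + i)" if "i \<le> n" for i
      using after[of "Suc j + i"] some[of "Suc j + i"] \<open>A k\<close> that k by (cases "i = n") auto
    have "i \<le> n \<Longrightarrow> a (Suc j + i) = a (Suc j) + i \<and> b (Suc j + i) = b (Suc j) \<and> c (Suc j + i) = c (Suc j)" for i
    proof (induction i)
      case (Suc i)
      then show ?case using only[of i] a_Suc[of "Suc j + i"] b_Suc[of "Suc j + i"] c_Suc[of "Suc j + i"] by simp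
    qed simp
    from this[of n] have n_le: "n \<le> b k" and bc: "b k = b (Suc j)" "c k = c (Suc j)"
      using 3(1) unfolding k by linarith+
    \<comment> \<open>Step \<open>j\<close> raises exactly one of \<open>b\<close> and
      \<open>c\<close>, and the lone run after it raises neither. The factor \<open>x * y\<close>
      covers both possibilities.\<close>
    have "x ^ b j * y ^ c j * (x * y) \<le> x ^ b k * y ^ c k"
    proof (cases "A j")
      case True
      then have "x ^ b j * y ^ c j * (x * y) = x * (x ^ b k * y ^ c k)"
        using j(2) by (simp add: bc b_Suc c_Suc mult_ac)
      also have "\<dots> \<le> x ^ b k * y ^ c k"
        using x y by (intro mult_left_le_one_le) auto
      finally show ?thesis .
    next
      case False
      then have "x ^ b j * y ^ c j * (x * y) = y * (x ^ b k * y ^ c k)"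
        using j(2) by (simp add: bc b_Suc c_Suc mult_ac)
      also have "\<dots> \<le> x ^ b k * y ^ c k"
        using x y by (intro mult_left_le_one_le) auto
      finally show ?thesis .
    qed
    then have at_j: "x ^ b j * y ^ c j \<le> x ^ b k * y ^ c k / (x * y)"
      using x y by (simp add: pos_le_divide_eq)
    have "\<sigma> k \<le> W * l ^ n * \<sigma> (Suc j)" using runA[of n "Suc j"] only unfolding k by blast
    also have "\<dots> \<le> W * l ^ b k * (g * (C * (x ^ b k * y ^ c k / (x * y))))"
    proof -
      have "\<sigma> (Suc j) \<le> g * \<sigma> j" by (rule growth)
      also have "\<dots> \<le> g * (C * (x ^ b j * y ^ c j))"
        using boundB[OF j(2)] nonneg by (intro mult_left_mono) (auto simp: mult.assoc)
      also have "\<dots> \<le> g * (C * (x ^ b k * y ^ c k / (x * y)))"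
        using nonneg by (intro mult_left_mono at_j) auto
      finally have "W * l ^ n * \<sigma> (Suc j) \<le> W * l ^ n * (g * (C * (x ^ b k * y ^ c k / (x * y))))"
        using nonneg l by (intro mult_left_mono) auto
      also have "\<dots> \<le> W * l ^ b k * (g * (C * (x ^ b k * y ^ c k / (x * y))))"
        using nonneg l n_le x y by (intro mult_right_mono mult_left_mono power_increasing) auto
      finally show ?thesis .
    qed
    also have "\<dots> = W * g * C / (x * y) * ((l * x) ^ b k * y ^ c k)"
      by (simp add: power_mult_distrib)
    also have "\<dots> \<le> W * g * C / (x * y) * y ^ k"
      using 3 total x y l nonneg by (intro mult_left_mono rate) auto
    finally show ?thesis using summand by linarith
  qed
qed

text \<open>By \<open>growth\<close>, a vanishing \<open>\<sigma>\<close> stays zero. So if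
  \<open>\<sigma> k\<close> is non-zero, every step up to \<open>k\<close> updates some part, and
  the roles of \<open>A\<close> and \<open>B\<close> can be chosen by which one is active at
  \<open>k\<close>.\<close>

lemma coupled_rate:
  fixes \<sigma> :: "nat \<Rightarrow> real" and A B :: "nat \<Rightarrow> bool"
  assumes x: "0 < x" "x \<le> 1" and y: "0 < y" "y \<le> 1" and l: "1 \<le> l" "l * x \<le> y\<^sup>2"
    and nonneg: "0 \<le> C" "0 \<le> W" "0 \<le> g" "\<And>k. 0 \<le> \<sigma> k"
    and boundA: "\<And>k. A k \<Longrightarrow>
      \<sigma> k \<le> C * x ^ card {i. i < k \<and> A i \<and> \<not> B i} * y ^ card {i. i < k \<and> A i \<and> B i}"
    and boundB: "\<And>k. B k \<Longrightarrow>
      \<sigma> k \<le> C * x ^ card {i. i < k \<and> B i \<and> \<not> A i} * y ^ card {i. i < k \<and> B i \<and> A i}"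
    and runA: "\<And>j n. (\<And>i. i \<le> n \<Longrightarrow> A (j + i) \<and> \<not> B (j + i)) \<Longrightarrow> \<sigma> (j + n) \<le> W * l ^ n * \<sigma> j"
    and runB: "\<And>j n. (\<And>i. i \<le> n \<Longrightarrow> B (j + i) \<and> \<not> A (j + i)) \<Longrightarrow> \<sigma> (j + n) \<le> W * l ^ n * \<sigma> j"
    and growth: "\<And>i. \<sigma> (Suc i) \<le> g * \<sigma> i"
    and some: "\<And>i. 0 < \<sigma> i \<Longrightarrow> A i \<or> B i"
  shows "\<sigma> k \<le> (C + W * g * C / (x * y)) * y ^ k"
proof (cases "\<sigma> k = 0")
  case True
  then show ?thesis using x y nonneg by simp
next
  case False
  have pos: "0 < \<sigma> i" if "i \<le> k" for i
  proof (rule ccontr)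
    assume "\<not> 0 < \<sigma> i"
    then have "\<sigma> i = 0" using nonneg(4)[of i] by simp
    then have "\<sigma> (i + n) = 0" for n
    proof (induction n)
      case (Suc n)
      then show ?case using growth[of "i + n"] nonneg(4)[of "Suc (i + n)"] by simp
    qed simp
    from this[of "k - i"] show False using that False by simp
  qed
  have some': "A i \<or> B i" "B i \<or> A i" if "i < k" for i
    using some[OF pos[of i]] that by auto
  have comm: "{i. i < k \<and> B i \<and> A i} = {i. i < k \<and> A i \<and> B i}" for k by blast
  show ?thesis
  proof (cases "A k")
    case True
    show ?thesis
      by (rule coupled_rate_aux[where A = A and B = B])
        (use assms some' True in \<open>auto simp: comm\<close>)
  next
    case False
    then have "B k" using some pos by blast
    show ?thesis
      by (rule coupled_rate_aux[where A = B and B = A])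
        (use assms some' \<open>B k\<close> in \<open>auto simp: comm\<close>)
  qed
qed

section \<open>Parity parts of a BMC function\<close>

lemma compact_closed_neighbourhood:
  assumes "0 < \<beta>"
  shows "compact {z. infdist z (complex_of_real ` {0..pi}) \<le> \<beta>}"
  using assms by (intro compact_infdist_le compact_continuous_image continuous_intros) auto

text \<open>A parity part is extended by \<open>F r z \<plusminus> F r (z - pi)\<close>, so both
  arguments must lie in the stadium. Working around \<open>{0..pi}\<close> makes the relevant
  diameter \<open>pi\<close> instead of \<open>2 * pi\<close>.\<close>

lemma shifted_neighbourhood_subset_stadium:
  assumes "infdist z (complex_of_real ` {0..pi}) \<le> \<beta>"
  shows "z \<in> stadium \<beta>" "z - of_real pi \<in> stadium \<beta>"
proof -
  have "closed (complex_of_real ` {0..pi})"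
    by (intro compact_imp_closed compact_continuous_image continuous_intros) auto
  then obtain w where w: "w \<in> complex_of_real ` {0..pi}"
    "infdist z (complex_of_real ` {0..pi}) = dist z w"
    using infdist_attains_inf[of "complex_of_real ` {0..pi}" z] by auto
  then obtain t where t: "t \<in> {0..pi}" "w = of_real t" by blast
  have "infdist z (complex_of_real ` {-pi..pi}) \<le> dist z (of_real t)"
    using t by (intro infdist_le imageI) auto
  then show "z \<in> stadium \<beta>" using assms w t by (simp add: stadium_def)
  have "infdist (z - of_real pi) (complex_of_real ` {-pi..pi}) \<le> dist (z - of_real pi) (of_real (t - pi))"
    using t by (intro infdist_le imageI) auto
  also have "\<dots> = dist z (of_real t)" by (simp add: dist_norm)
  finally show "z - of_real pi \<in> stadium \<beta>" using assms w t by (simp add: stadium_def)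
qed

text \<open>Points at distance less than \<open>\<beta>\<close> from the interval form an open set,
  hence are interior.\<close>

lemma frontier_neighbourhood_dist:
  assumes "z \<in> frontier {z. infdist z (complex_of_real ` {0..pi}) \<le> \<beta>}" "t \<in> {0..pi}"
  shows "\<beta> \<le> cmod (z - of_real t)"
proof (rule ccontr)
  assume "\<not> \<beta> \<le> cmod (z - of_real t)"
  moreover have "infdist z (complex_of_real ` {0..pi}) \<le> dist z (of_real t)"
    using assms by (intro infdist_le imageI) auto
  ultimately have "z \<in> {z. infdist z (complex_of_real ` {0..pi}) < \<beta>}"
    by (simp add: dist_norm)
  moreover have "open {z. infdist z (complex_of_real ` {0..pi}) < \<beta>}"
    by (intro open_Collect_less continuous_intros)
  ultimately have "z \<in> interior {z. infdist z (complex_of_real ` {0..pi}) \<le> \<beta>}"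
    by (intro interiorI[of "{z. infdist z (complex_of_real ` {0..pi}) < \<beta>}"]) auto
  then show False using assms by (simp add: frontier_def)
qed

text \<open>The BMC structure with \<open>g\<close> and \<open>h\<close> eliminated: invariance
  under the shift by \<open>pi\<close> combined with the reflection of the radius.\<close>

definition bmc_symmetric :: "(real \<Rightarrow> real \<Rightarrow> real) \<Rightarrow> bool" where
  "bmc_symmetric e \<longleftrightarrow> (\<forall>t\<in>{0..pi}. \<forall>r\<in>{0..1}. e t (- r) = e (t - pi) r \<and> e (t - pi) (- r) = e t r)"

text \<open>At a pivot the even and odd parts take the values \<open>a + b\<close> and
  \<open>b - a\<close>, the eigenvalues of the pivot matrix up to the sign of the second.\<close>

definition even_part :: "(real \<Rightarrow> real \<Rightarrow> real) \<Rightarrow> real \<Rightarrow> real \<Rightarrow> real" where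
  "even_part e t r = e t r + e (t - pi) r"

definition odd_part :: "(real \<Rightarrow> real \<Rightarrow> real) \<Rightarrow> real \<Rightarrow> real \<Rightarrow> real" where
  "odd_part e t r = e t r - e (t - pi) r"

lemma is_BMC_imp_symmetric:
  assumes "is_BMC f"
  shows "bmc_symmetric f"
proof -
  obtain g h :: "real \<Rightarrow> real \<Rightarrow> real" where
    1: "\<forall>\<theta>\<in>{-pi..0}. \<forall>\<rho>\<in>{0..1}. f \<theta> \<rho> = g (\<theta> + pi) \<rho>" and
    2: "\<forall>\<theta>\<in>{0..pi}. \<forall>\<rho>\<in>{0..1}. f \<theta> \<rho> = h \<theta> \<rho>" and
    3: "\<forall>\<theta>\<in>{0..pi}. \<forall>\<rho>\<in>{-1..0}. f \<theta> \<rho> = g \<theta> (- \<rho>)" and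
    4: "\<forall>\<theta>\<in>{-pi..0}. \<forall>\<rho>\<in>{-1..0}. f \<theta> \<rho> = h (\<theta> + pi) (- \<rho>)"
    using assms unfolding is_BMC_def by (elim exE conjE) (rule that)
  show ?thesis
    unfolding bmc_symmetric_def
  proof (intro ballI conjI)
    fix t r :: real assume tr: "t \<in> {0..pi}" "r \<in> {0..1}"
    show "f t (- r) = f (t - pi) r"
      using bspec[OF bspec[OF 3], of t "- r"] bspec[OF bspec[OF 1], of "t - pi" r] tr by simp
    show "f (t - pi) (- r) = f t r"
      using bspec[OF bspec[OF 4], of "t - pi" "- r"] bspec[OF bspec[OF 2], of t r] tr by simp
  qed
qed

lemma bmc_symmetricD:
  assumes "bmc_symmetric e" "t \<in> {0..pi}" "r \<in> {0..1}"
  shows "e t (- r) = e (t - pi) r" "e (t - pi) (- r) = e t r"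
  using assms by (auto simp: bmc_symmetric_def)

lemma ge_step_eq:
  "ge_step \<alpha> e tk rk t r = e t r -
    (even_part e tk r * fst (pinv_coeffs \<alpha> (e (tk - pi) rk) (e tk rk)) * (e t rk + e t (- rk)) -
     odd_part e tk r * snd (pinv_coeffs \<alpha> (e (tk - pi) rk) (e tk rk)) * (e t rk - e t (- rk))) / 2"
proof -
  have "even_part e tk r = e (tk - pi) r + e tk r" "odd_part e tk r = - (e (tk - pi) r - e tk r)"
    by (simp_all add: even_part_def odd_part_def)
  then show ?thesis
    unfolding ge_step_def Let_def case_prod_beta
    by (simp only: mult_minus_left diff_minus_eq_add)
qed

context
  fixes \<alpha> :: real and e e' :: "real \<Rightarrow> real \<Rightarrow> real" and tk rk :: real
  assumes sym: "bmc_symmetric e" and tk: "tk \<in> {0..pi}" and rk: "rk \<in> {0..1}"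
    and e': "e' = ge_step \<alpha> e tk rk"
begin

text \<open>Shifting \<open>t\<close> by \<open>pi\<close> exchanges \<open>e t rk\<close> and
  \<open>e t (- rk)\<close>: their sum stays, their difference changes sign. Reflecting
  \<open>r\<close> acts alike on the even and odd coefficients in front of them.\<close>

lemma bmc_symmetric_ge_step: "bmc_symmetric e'"
  unfolding bmc_symmetric_def
proof (intro ballI)
  fix t r :: real assume tr: "t \<in> {0..pi}" "r \<in> {0..1}"
  have reflect: "even_part e tk (- r) = even_part e tk r" "odd_part e tk (- r) = - odd_part e tk r"
    using bmc_symmetricD[OF sym tk tr(2)] by (simp_all add: even_part_def odd_part_def)
  show "e' t (- r) = e' (t - pi) r \<and> e' (t - pi) (- r) = e' t r"
    unfolding e' ge_step_eq reflect bmc_symmetricD[OF sym tr(1) rk] bmc_symmetricD[OF sym tr]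
    by (simp add: algebra_simps)
qed

text \<open>In the sum over \<open>t\<close> and \<open>t - pi\<close> the odd term cancels. The
  update of rank at most two thus decouples into at most one rank-one update per parity.\<close>

lemma even_part_ge_step:
  assumes "t \<in> {0..pi}"
  shows "even_part e' t r = even_part e t r -
    even_part e tk r * fst (pinv_coeffs \<alpha> (e (tk - pi) rk) (e tk rk)) * even_part e t rk"
  unfolding even_part_def[of _ t] e' ge_step_eq bmc_symmetricD[OF sym assms rk]
  by (simp add: field_simps)

lemma odd_part_ge_step:
  assumes "t \<in> {0..pi}"
  shows "odd_part e' t r = odd_part e t r +
    odd_part e tk r * snd (pinv_coeffs \<alpha> (e (tk - pi) rk) (e tk rk)) * odd_part e t rk"
  unfolding odd_part_def[of _ t] e' ge_step_eq bmc_symmetricD[OF sym assms rk]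
  by (simp add: field_simps)

end



section \<open>The coupling rule: which parity parts a step updates\<close>

definition updated :: "real \<Rightarrow> real \<Rightarrow> real \<Rightarrow> bool" where
  "updated \<alpha> x y \<longleftrightarrow> x \<noteq> 0 \<and> \<alpha> * \<bar>y\<bar> \<le> \<bar>x\<bar>"

lemma updated_if_larger:
  assumes "0 < \<alpha>" "\<alpha> < 1" "\<bar>y\<bar> \<le> \<bar>x\<bar>" "x \<noteq> 0"
  shows "updated \<alpha> x y"
proof -
  have "\<alpha> * \<bar>y\<bar> \<le> \<bar>y\<bar>" using assms by (intro mult_left_le_one_le) auto
  then show ?thesis using assms(3,4) unfolding updated_def by linarith
qed

lemma updated_dominates:
  assumes "0 < \<alpha>" "\<alpha> < 1" "updated \<alpha> x y"
  shows "\<alpha> * max \<bar>x\<bar> \<bar>y\<bar> \<le> \<bar>x\<bar>"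
proof -
  have "\<alpha> * \<bar>x\<bar> \<le> \<bar>x\<bar>" using assms by (intro mult_left_le_one_le) auto
  then show ?thesis using assms(3) by (cases "\<bar>x\<bar> \<le> \<bar>y\<bar>") (auto simp: updated_def max_def)
qed

text \<open>A non-zero pivot value that is at least as large as the other is always updated, as
  \<open>\<alpha> < 1\<close>. So a lone step is complete pivoting for the part it updates.\<close>

lemma only_updated_max:
  assumes "0 < \<alpha>" "\<alpha> < 1" "\<not> updated \<alpha> y x"
  shows "max \<bar>x\<bar> \<bar>y\<bar> = \<bar>x\<bar>"
proof -
  have "\<bar>y\<bar> \<le> \<bar>x\<bar>" using updated_if_larger[OF assms(1,2), of x y] assms(3) by fastforce
  then show ?thesis by simp
qed

lemma updated_or_updated:
  assumes "0 < \<alpha>" "\<alpha> < 1" "0 < max \<bar>x\<bar> \<bar>y\<bar>"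
  shows "updated \<alpha> x y \<or> updated \<alpha> y x"
proof (cases "\<bar>y\<bar> \<le> \<bar>x\<bar>")
  case True
  then have "x \<noteq> 0" using assms(3) by auto
  then show ?thesis using updated_if_larger[OF assms(1,2) True] by blast
next
  case False
  then have "\<bar>x\<bar> \<le> \<bar>y\<bar>" "y \<noteq> 0" by auto
  then show ?thesis using updated_if_larger[OF assms(1,2)] by blast
qed

text \<open>Since \<open>\<alpha> < 1\<close>, the two truncating cases exclude each other and the
  three-way choice becomes one test per parity. The condition \<open>x \<noteq> 0\<close> in
  \<open>updated\<close> accounts for a zero matrix, where \<open>1 / 0 = 0\<close>. The minus sign
  reflects the odd pivot value \<open>b - a\<close>.\<close>

lemma pinv_coeffs_updated:
  assumes "0 < \<alpha>" "\<alpha> < 1"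
  shows "fst (pinv_coeffs \<alpha> a b) = (if updated \<alpha> (b + a) (b - a) then 1 / (b + a) else 0)"
    and "snd (pinv_coeffs \<alpha> a b) = (if updated \<alpha> (b - a) (b + a) then - 1 / (b - a) else 0)"
proof -
  have le: "\<alpha> * \<bar>a + b\<bar> \<le> \<bar>a + b\<bar>" "\<alpha> * \<bar>b - a\<bar> \<le> \<bar>b - a\<bar>"
    using assms by (auto intro!: mult_left_le_one_le)
  have comm: "b + a = a + b" "\<bar>a - b\<bar> = \<bar>b - a\<bar>" "1 / (a - b) = - 1 / (b - a)"
    using minus_divide_divide[of 1 "a - b"] by (simp_all add: abs_minus_commute)
  note defs = pinv_coeffs_def updated_def comm
  consider (fst) "\<bar>b - a\<bar> < \<alpha> * \<bar>a + b\<bar>" | (snd) "\<bar>a + b\<bar> < \<alpha> * \<bar>b - a\<bar>"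
    | (both) "\<alpha> * \<bar>a + b\<bar> \<le> \<bar>b - a\<bar>" "\<alpha> * \<bar>b - a\<bar> \<le> \<bar>a + b\<bar>" by linarith
  then have "fst (pinv_coeffs \<alpha> a b) = (if updated \<alpha> (b + a) (b - a) then 1 / (b + a) else 0) \<and>
    snd (pinv_coeffs \<alpha> a b) = (if updated \<alpha> (b - a) (b + a) then - 1 / (b - a) else 0)"
  proof cases
    case fst
    then have "a + b \<noteq> 0" "\<alpha> * \<bar>b - a\<bar> \<le> \<bar>a + b\<bar>" "\<not> \<alpha> * \<bar>a + b\<bar> \<le> \<bar>b - a\<bar>"
      using le by auto
    then show ?thesis using fst unfolding defs by simp
  next
    case snd
    then have "b - a \<noteq> 0" "\<alpha> * \<bar>a + b\<bar> \<le> \<bar>b - a\<bar>" "\<not> \<alpha> * \<bar>b - a\<bar> \<le> \<bar>a + b\<bar>"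
      "\<not> \<bar>b - a\<bar> < \<alpha> * \<bar>a + b\<bar>"
      using le by linarith+
    then show ?thesis using snd unfolding defs by simp
  next
    case both
    then have "\<not> \<bar>b - a\<bar> < \<alpha> * \<bar>a + b\<bar>" "\<not> \<bar>a + b\<bar> < \<alpha> * \<bar>b - a\<bar>" by linarith+
    then show ?thesis using both unfolding defs by simp
  qed
  then show "fst (pinv_coeffs \<alpha> a b) = (if updated \<alpha> (b + a) (b - a) then 1 / (b + a) else 0)"
    "snd (pinv_coeffs \<alpha> a b) = (if updated \<alpha> (b - a) (b + a) then - 1 / (b - a) else 0)"
    by simp_all
qed

text \<open>The other part enters only through its pivot values \<open>v\<close>, so one locale
  serves both parities with roles exchanged. \<open>le_max\<close> is the maximality of the largest
  singular value at the pivot.\<close>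

locale parity_part =
  cross_elimination u "{0..pi}" "{0..1}" tp rp "\<lambda>k. updated \<alpha> (u k (tp k) (rp k)) (v k)"
  for u :: "nat \<Rightarrow> real \<Rightarrow> real \<Rightarrow> real" and tp rp :: "nat \<Rightarrow> real"
    and \<alpha> :: real and v :: "nat \<Rightarrow> real" +
  assumes \<alpha>: "0 < \<alpha>" "\<alpha> < 1"
    and le_max: "t \<in> {0..pi} \<Longrightarrow> r \<in> {0..1} \<Longrightarrow> \<bar>u k t r\<bar> \<le> max \<bar>u k (tp k) (rp k)\<bar> \<bar>v k\<bar>"
begin

abbreviation q :: "nat \<Rightarrow> real" where "q k \<equiv> u k (tp k) (rp k)"
abbreviation \<sigma> :: "nat \<Rightarrow> real" where "\<sigma> k \<equiv> max \<bar>q k\<bar> \<bar>v k\<bar>"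

lemma \<sigma>_le: "updated \<alpha> (q k) (v k) \<Longrightarrow> \<sigma> k \<le> \<bar>q k\<bar> / \<alpha>"
  using updated_dominates[OF \<alpha>, of "q k" "v k"] \<alpha>(1)
  by (simp only: pos_le_divide_eq mult.commute)

text \<open>An updated part has a pivot of at least \<open>\<alpha> * \<sigma> k\<close>, so the
  elimination multiplier is at most \<open>1 / \<alpha>\<close>.\<close>

lemma growth_Suc:
  assumes "t \<in> {0..pi}" "r \<in> {0..1}"
  shows "\<bar>u (Suc k) t r\<bar> \<le> (1 + 1 / \<alpha>) * \<sigma> k"
proof (cases "updated \<alpha> (q k) (v k)")
  case True
  have q: "0 < \<bar>q k\<bar>" using pivot[OF True] by simp
  have "\<bar>u k (tp k) r\<bar> \<le> \<bar>q k\<bar> / \<alpha>"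
    using le_max[OF tp assms(2)] \<sigma>_le[OF True] by (rule order_trans)
  then have "\<bar>u k (tp k) r * u k t (rp k)\<bar> \<le> (\<bar>q k\<bar> / \<alpha>) * \<sigma> k"
    unfolding abs_mult by (rule mult_mono[OF _ le_max[OF assms(1) rp]]) (use \<alpha> in auto)
  then have "\<bar>u k (tp k) r * u k t (rp k) / q k\<bar> \<le> (\<bar>q k\<bar> / \<alpha>) * \<sigma> k / \<bar>q k\<bar>"
    unfolding abs_divide by (rule divide_right_mono) simp
  also have "\<dots> = 1 / \<alpha> * \<sigma> k" using q by simp
  finally have "\<bar>u k t r - u k (tp k) r * u k t (rp k) / q k\<bar> \<le> \<sigma> k + 1 / \<alpha> * \<sigma> k"
    using le_max[OF assms, of k] by linarith
  then show ?thesis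
    unfolding update[OF True assms] by (simp only: distrib_right mult_1)
next
  case False
  have "\<bar>u k t r\<bar> \<le> 1 * \<sigma> k" using le_max[OF assms] by simp
  also have "\<dots> \<le> (1 + 1 / \<alpha>) * \<sigma> k"
    using \<alpha> by (intro mult_right_mono) (auto simp: le_max_iff_disj)
  finally show ?thesis using idle[OF False assms] by simp
qed

lemma growth_only_updated:
  assumes "1 < l"
    and only: "\<And>i. i \<le> n \<Longrightarrow> updated \<alpha> (q (s + i)) (v (s + i)) \<and> \<not> updated \<alpha> (v (s + i)) (q (s + i))"
  shows "\<sigma> (s + n) \<le> exp (64 / ln l) * l ^ n * \<sigma> s"
proof -
  have \<sigma>: "\<sigma> (s + i) = \<bar>q (s + i)\<bar>" if "i \<le> n" for i
    using only_updated_max[OF \<alpha>] only[OF that] by blast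
  have "\<bar>q (s + n)\<bar> \<le> exp (64 / ln l) * l ^ n * \<bar>q s\<bar>"
  proof (rule growth_complete_pivoting)
    show "\<bar>u (s + i) t r\<bar> \<le> \<bar>q (s + i)\<bar>" if "i \<le> n" "t \<in> {0..pi}" "r \<in> {0..1}" for i t r
      using le_max[OF that(2,3), of "s + i"] unfolding \<sigma>[OF that(1)] .
  qed (use assms in blast)+
  then show ?thesis using \<sigma>[of n] \<sigma>[of 0] by simp
qed

text \<open>\<open>\<epsilon>\<close> is 1 for the even and -1 for the odd part; the sum of two
  extensions accounts for \<open>2 * D\<close>. The factor \<open>1 / \<alpha>\<close> passes from
  the pivot to \<open>\<sigma> k\<close>, which \<open>upd\<close> permits.\<close>

lemma decay_rate:
  fixes F :: "real \<Rightarrow> complex \<Rightarrow> complex"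
  assumes "1 < \<kappa>" and \<beta>: "\<beta> = (1 + 1 / \<alpha>) * 2 * pi * \<kappa>"
    and analytic: "\<And>r. r \<in> {0..1} \<Longrightarrow> F r analytic_on stadium \<beta>"
    and extends: "\<And>r t. r \<in> {0..1} \<Longrightarrow> t \<in> {-pi..pi} \<Longrightarrow> F r (of_real t) = of_real (f t r)"
    and bound: "\<And>r z. r \<in> {0..1} \<Longrightarrow> z \<in> stadium \<beta> \<Longrightarrow> cmod (F r z) \<le> D"
    and u0: "\<And>t r. u 0 t r = f t r + \<epsilon> * f (t - pi) r" and \<epsilon>: "\<bar>\<epsilon>\<bar> = 1"
    and y: "1 / (2 * \<kappa>) \<le> y"
    and upd: "updated \<alpha> (q k) (v k)"
  shows "\<sigma> k \<le> 2 * D / \<alpha> *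
    (1 / (\<kappa> * (1 + 1 / \<alpha>))) ^ card {i. i < k \<and> updated \<alpha> (q i) (v i) \<and> \<not> updated \<alpha> (v i) (q i)} *
    y ^ card {i. i < k \<and> updated \<alpha> (q i) (v i) \<and> updated \<alpha> (v i) (q i)}"
proof -
  let ?A = "\<lambda>i. updated \<alpha> (q i) (v i)" and ?B = "\<lambda>i. updated \<alpha> (v i) (q i)"
  define K where "K = {z. infdist z (complex_of_real ` {0..pi}) \<le> \<beta>}"
  \<comment> \<open>Bounds the ratio of entries to the pivot: a lone step is complete pivoting,
    whereas in a joint step the pivot may be smaller by the factor \<open>\<alpha>\<close>.\<close>
  define c where "c i = (if ?B i then 1 / \<alpha> else 1)" for i
  define x where "x = 1 / (\<kappa> * (1 + 1 / \<alpha>))"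
  have pos: "0 < 1 + 1 / \<alpha>" using \<alpha> by (simp add: add_pos_pos)
  have \<beta>_pos: "0 < \<beta>" using pos assms(1) by (simp add: \<beta>)
  have K_stadium: "z \<in> stadium \<beta>" "z - of_real pi \<in> stadium \<beta>" if "z \<in> K" for z
    using that shifted_neighbourhood_subset_stadium by (auto simp: K_def)
  have K0: "0 \<in> K" using \<beta>_pos by (simp add: K_def image_iff)
  have D: "0 \<le> D"
    using bound[of 0 0] K_stadium(1)[OF K0] norm_ge_zero[of "F 0 0"]
    by (simp del: norm_ge_zero)
  have "\<bar>q k\<bar> \<le> 2 * D * (\<Prod>i | i < k \<and> ?A i. (1 + c i) * (pi / \<beta>))"
  proof (rule decay[where K = K and G = "\<lambda>r z. F r z + of_real \<epsilon> * F r (z - of_real pi)"])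
    show "compact K" unfolding K_def using \<beta>_pos by (rule compact_closed_neighbourhood)
    show "complex_of_real ` {0..pi} \<subseteq> K" using \<beta>_pos by (auto simp: K_def)
    show "\<beta> \<le> cmod (z - of_real t)" if "z \<in> frontier K" "t \<in> {0..pi}" for z t
      using that unfolding K_def by (rule frontier_neighbourhood_dist)
    show "(\<lambda>z. F r z + of_real \<epsilon> * F r (z - of_real pi)) analytic_on K" if "r \<in> {0..1}" for r
    proof -
      have "(\<lambda>z. z - complex_of_real pi) analytic_on K"
        by (intro analytic_on_diff analytic_on_ident analytic_on_const)
      then have "(F r \<circ> (\<lambda>z. z - complex_of_real pi)) analytic_on K"
        using analytic[OF that] by (rule analytic_on_compose_gen) (rule K_stadium)
      moreover have "F r analytic_on K"
        using analytic[OF that] by (rule analytic_on_subset) (use K_stadium in blast)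
      ultimately show ?thesis
        by (intro analytic_on_add analytic_on_mult analytic_on_const) (simp_all add: o_def)
    qed
    show "F r (of_real t) + of_real \<epsilon> * F r (of_real t - of_real pi) = of_real (u 0 t r)"
      if "r \<in> {0..1}" "t \<in> {0..pi}" for r t
      using that extends[of r t] extends[of r "t - pi"] by (simp add: u0)
    show "cmod (F r z + of_real \<epsilon> * F r (z - of_real pi)) \<le> 2 * D" if "r \<in> {0..1}" "z \<in> K" for r z
    proof -
      have "cmod (F r z + of_real \<epsilon> * F r (z - of_real pi)) \<le> cmod (F r z) + cmod (F r (z - of_real pi))"
        by (rule norm_triangle_le) (simp add: norm_mult \<epsilon>)
      then show ?thesis
        using bound[OF that(1) K_stadium(1)[OF that(2)]] bound[OF that(1) K_stadium(2)[OF that(2)]]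
        by simp
    qed
    show "\<bar>u i t r\<bar> \<le> c i * \<bar>q i\<bar>" if "?A i" "t \<in> {0..pi}" "r \<in> {0..1}" for i t r
    proof -
      have "\<sigma> i \<le> c i * \<bar>q i\<bar>"
      proof (cases "?B i")
        case True
        then show ?thesis using \<sigma>_le[OF that(1)] by (simp only: c_def if_True mult_1 times_divide_eq_left)
      next
        case False
        then show ?thesis using only_updated_max[OF \<alpha> False] by (simp only: c_def if_False mult_1 order_refl)
      qed
      then show ?thesis using le_max[OF that(2,3), of i] by linarith
    qed
  qed (use \<beta>_pos tp rp in auto)
  \<comment> \<open>Here \<open>pi / \<beta> = 1 / (2 * \<kappa> * g)\<close> with
    \<open>g = 1 + 1 / \<alpha>\<close>. A joint step multiplies this by \<open>g\<close>, a lone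
    one by 2.\<close>
  also have "(\<Prod>i | i < k \<and> ?A i. (1 + c i) * (pi / \<beta>)) =
      (\<Prod>i | i < k \<and> ?A i. if ?B i then 1 / (2 * \<kappa>) else x)"
  proof (rule prod.cong[OF refl])
    fix i
    define g where "g = 1 + 1 / \<alpha>"
    have "1 + c i = (if ?B i then g else 2)" by (simp add: c_def g_def)
    then show "(1 + c i) * (pi / \<beta>) = (if ?B i then 1 / (2 * \<kappa>) else x)"
      using pos assms(1) unfolding \<beta> x_def g_def[symmetric] by (simp add: field_simps)
  qed
  also have "\<dots> = (1 / (2 * \<kappa>)) ^ card {i. i < k \<and> ?A i \<and> ?B i} * x ^ card {i. i < k \<and> ?A i \<and> \<not> ?B i}"
  proof -
    have "{i. i < k \<and> ?A i} \<inter> {i. ?B i} = {i. i < k \<and> ?A i \<and> ?B i}"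
      "{i. i < k \<and> ?A i} \<inter> - {i. ?B i} = {i. i < k \<and> ?A i \<and> \<not> ?B i}" by auto
    then show ?thesis by (subst prod.If_cases) simp_all
  qed
  also have "2 * D * \<dots> \<le> 2 * D * (y ^ card {i. i < k \<and> ?A i \<and> ?B i} * x ^ card {i. i < k \<and> ?A i \<and> \<not> ?B i})"
    using D y assms(1) pos by (intro mult_left_mono mult_right_mono power_mono) (auto simp: x_def)
  finally have "\<bar>q k\<bar> / \<alpha> \<le> 2 * D / \<alpha> * x ^ card {i. i < k \<and> ?A i \<and> \<not> ?B i} * y ^ card {i. i < k \<and> ?A i \<and> ?B i}"
    using \<alpha> by (simp add: field_simps)
  with \<sigma>_le[OF upd] show ?thesis unfolding x_def by (rule order_trans)
qed

end

section \<open>Geometric decay of the residual from the two coupled parity parts\<close>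

theorem theorem3p4:
  fixes \<alpha> \<kappa> :: real and f :: "real \<Rightarrow> real \<Rightarrow> real"
    and F :: "real \<Rightarrow> complex \<Rightarrow> complex"
    and e :: "nat \<Rightarrow> real \<Rightarrow> real \<Rightarrow> real" and tp rp :: "nat \<Rightarrow> real"
  assumes "0 < \<alpha>" "\<alpha> < 1" "\<kappa> > 1"
    and "is_BMC f"
    and "\<forall>\<theta>\<in>{-pi..pi}. continuous_on {-1..1} (\<lambda>\<rho>. f \<theta> \<rho>)"
    and "\<forall>\<rho>\<in>{-1..1}. F \<rho> analytic_on stadium (max 2 (1 + 1 / \<alpha>) * 2 * pi * \<kappa>)"
    and "\<forall>\<rho>\<in>{-1..1}. \<forall>\<theta>\<in>{-pi..pi}. F \<rho> (complex_of_real \<theta>) = complex_of_real (f \<theta> \<rho>)"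
    and "\<exists>B. \<forall>\<rho>\<in>{-1..1}. \<forall>z\<in>stadium (max 2 (1 + 1 / \<alpha>) * 2 * pi * \<kappa>). cmod (F \<rho> z) \<le> B"
    and "bmc_GE_run \<alpha> f e tp rp"
  shows "\<exists>C>0. \<forall>k. \<forall>\<theta>\<in>{-pi..pi}. \<forall>\<rho>\<in>{-1..1}.
           \<bar>f \<theta> \<rho> - (f \<theta> \<rho> - e k \<theta> \<rho>)\<bar> \<le> C * (min \<kappa> (1 / \<alpha>)) powr (- real k)"
proof -
  have \<alpha>: "0 < \<alpha>" "\<alpha> < 1" by fact+
  have e0: "e 0 = f" and e_Suc: "e (Suc k) = ge_step \<alpha> (e k) (tp k) (rp k)"
    and valid: "valid_pivot (e k) (tp k) (rp k)" for k
    using assms(9) by (auto simp: bmc_GE_run_def)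
  have tp: "tp k \<in> {0..pi}" and rp: "rp k \<in> {0..1}" for k
    using valid[of k] by (auto simp: valid_pivot_def)
  have sym: "bmc_symmetric (e k)" for k
  proof (induction k)
    case 0
    show ?case using is_BMC_imp_symmetric[OF assms(4)] by (simp add: e0)
  next
    case (Suc k)
    show ?case by (rule bmc_symmetric_ge_step[OF Suc tp rp e_Suc])
  qed
  define p m where "p k = even_part (e k)" and "m k = odd_part (e k)" for k
  define P M where "P k = p k (tp k) (rp k)" and "M k = m k (tp k) (rp k)" for k
  \<comment> \<open>The largest singular value of the pivot matrix, which the pivot choice
    maximises.\<close>
  define \<sigma> where "\<sigma> k = max \<bar>P k\<bar> \<bar>M k\<bar>" for k
  have le_\<sigma>: "\<bar>p k t r\<bar> \<le> \<sigma> k" "\<bar>m k t r\<bar> \<le> \<sigma> k" if "t \<in> {0..pi}" "r \<in> {0..1}" for k t r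
  proof -
    have "sigma1 (e k (t - pi) r) (e k t r) \<le> sigma1 (e k (tp k - pi) (rp k)) (e k (tp k) (rp k))"
      using valid[of k] that by (simp add: valid_pivot_def)
    then show "\<bar>p k t r\<bar> \<le> \<sigma> k" "\<bar>m k t r\<bar> \<le> \<sigma> k"
      by (simp_all add: \<sigma>_def P_def M_def p_def m_def even_part_def odd_part_def sigma1_def
          add.commute abs_minus_commute)
  qed
  have pinv: "fst (pinv_coeffs \<alpha> (e k (tp k - pi) (rp k)) (e k (tp k) (rp k))) =
      (if updated \<alpha> (P k) (M k) then 1 / P k else 0)"
    "snd (pinv_coeffs \<alpha> (e k (tp k - pi) (rp k)) (e k (tp k) (rp k))) =
      (if updated \<alpha> (M k) (P k) then - 1 / M k else 0)" for k
    unfolding pinv_coeffs_updated[OF \<alpha>] P_def M_def p_def m_def even_part_def odd_part_def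
    by (rule refl)+
  have p_Suc: "p (Suc k) t r = p k t r - (if updated \<alpha> (P k) (M k) then p k (tp k) r * p k t (rp k) / P k else 0)"
    and m_Suc: "m (Suc k) t r = m k t r - (if updated \<alpha> (M k) (P k) then m k (tp k) r * m k t (rp k) / M k else 0)"
    if "t \<in> {0..pi}" "r \<in> {0..1}" for k t r
    unfolding p_def m_def even_part_ge_step[OF sym tp rp e_Suc that(1)]
      odd_part_ge_step[OF sym tp rp e_Suc that(1)] pinv by simp_all
  interpret P: parity_part p tp rp \<alpha> M
    by unfold_locales
      (use tp rp \<alpha> p_Suc le_\<sigma> in \<open>auto simp: updated_def \<sigma>_def simp flip: P_def\<close>)
  interpret M: parity_part m tp rp \<alpha> P
    by unfold_locales
      (use tp rp \<alpha> m_Suc le_\<sigma> in \<open>auto simp: updated_def \<sigma>_def max.commute simp flip: M_def\<close>)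

  define \<beta> where "\<beta> = (1 + 1 / \<alpha>) * 2 * pi * \<kappa>"
  define \<mu> where "\<mu> = min \<kappa> (1 / \<alpha>)"
  define x where "x = 1 / (\<kappa> * (1 + 1 / \<alpha>))"
  define y where "y = 1 / \<mu>"
  have \<mu>: "1 < \<mu>" using \<alpha> assms(3) by (simp add: \<mu>_def)
  have y: "0 < y" "y \<le> 1" "1 / \<kappa> \<le> y" "\<alpha> \<le> y"
    using \<mu> \<alpha> assms(3) by (auto simp: y_def \<mu>_def field_simps min_def)
  have x: "0 < x" "x \<le> 1"
    using \<alpha> assms(3) mult_mono[of 1 \<kappa> 1 "1 + 1 / \<alpha>"] by (auto simp: x_def add_pos_pos)
  have y2: "1 / (2 * \<kappa>) \<le> y"
    by (rule order_trans[OF _ y(3)]) (use assms(3) in \<open>simp add: field_simps\<close>)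
  \<comment> \<open>The growth rate \<open>l = 1 + \<alpha>\<close> is chosen to cancel the same
    factor in the denominator of \<open>x\<close>; what remains is bounded by
    \<open>1 / \<kappa> \<le> y\<close> and \<open>\<alpha> \<le> y\<close>.\<close>
  have "1 + 1 / \<alpha> = (1 + \<alpha>) / \<alpha>" "1 + \<alpha> \<noteq> 0" using \<alpha> by (auto simp: field_simps)
  then have "(1 + \<alpha>) * x = \<alpha> * (1 / \<kappa>)" by (simp add: x_def)
  also have "\<dots> \<le> y * y" using y \<alpha> assms(3) by (intro mult_mono) auto
  finally have lx: "(1 + \<alpha>) * x \<le> y\<^sup>2" by (simp add: power2_eq_square)
  have "max 2 (1 + 1 / \<alpha>) = 1 + 1 / \<alpha>" using \<alpha> by (simp add: field_simps)
  then have max_\<beta>: "max 2 (1 + 1 / \<alpha>) * 2 * pi * \<kappa> = \<beta>" by (simp add: \<beta>_def)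
  obtain D0 where D0: "\<And>r z. r \<in> {-1..1} \<Longrightarrow> z \<in> stadium \<beta> \<Longrightarrow> cmod (F r z) \<le> D0"
    using assms(8) unfolding max_\<beta> by blast
  \<comment> \<open>Clipping at 0 supplies the non-negative constant that
    \<open>coupled_rate\<close> asks for.\<close>
  define D where "D = max D0 0"
  have F: "F r analytic_on stadium \<beta>" "\<And>t. t \<in> {-pi..pi} \<Longrightarrow> F r (of_real t) = of_real (f t r)"
    "\<And>z. z \<in> stadium \<beta> \<Longrightarrow> cmod (F r z) \<le> D" if "r \<in> {0..1}" for r
    using assms(6,7) D0 that unfolding max_\<beta> by (auto simp: D_def le_max_iff_disj)
  have p0: "p 0 t r = f t r + 1 * f (t - pi) r" and m0: "m 0 t r = f t r + (-1) * f (t - pi) r" for t r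
    by (simp_all add: p_def m_def e0 even_part_def odd_part_def)
  define W where "W = exp (64 / ln (1 + \<alpha>))"
  define C where "C = 2 * D / \<alpha> + W * (1 + 1 / \<alpha>) * (2 * D / \<alpha>) / (x * y)"
  have rate: "\<sigma> k \<le> C * y ^ k" for k
    unfolding C_def
  proof (rule coupled_rate[where l = "1 + \<alpha>" and A = "\<lambda>k. updated \<alpha> (P k) (M k)"
        and B = "\<lambda>k. updated \<alpha> (M k) (P k)"])
    show "\<sigma> k \<le> 2 * D / \<alpha> * x ^ card {i. i < k \<and> updated \<alpha> (P i) (M i) \<and> \<not> updated \<alpha> (M i) (P i)} *
        y ^ card {i. i < k \<and> updated \<alpha> (P i) (M i) \<and> updated \<alpha> (M i) (P i)}"
      if "updated \<alpha> (P k) (M k)" for k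
      unfolding \<sigma>_def P_def x_def
      by (rule P.decay_rate[where F = F and f = f, OF assms(3) \<beta>_def F p0 _ y2])
        (use that in \<open>simp_all add: P_def\<close>)
    show "\<sigma> k \<le> 2 * D / \<alpha> * x ^ card {i. i < k \<and> updated \<alpha> (M i) (P i) \<and> \<not> updated \<alpha> (P i) (M i)} *
        y ^ card {i. i < k \<and> updated \<alpha> (M i) (P i) \<and> updated \<alpha> (P i) (M i)}"
      if "updated \<alpha> (M k) (P k)" for k
      unfolding \<sigma>_def max.commute[of "\<bar>P k\<bar>"] M_def x_def
      by (rule M.decay_rate[where F = F and f = f, OF assms(3) \<beta>_def F m0 _ y2])
        (use that in \<open>simp_all add: M_def\<close>)
    show "\<sigma> (j + n) \<le> W * (1 + \<alpha>) ^ n * \<sigma> j"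
      if "\<And>i. i \<le> n \<Longrightarrow> updated \<alpha> (P (j + i)) (M (j + i)) \<and> \<not> updated \<alpha> (M (j + i)) (P (j + i))" for j n
      unfolding \<sigma>_def P_def W_def
      by (rule P.growth_only_updated) (use that \<alpha> in \<open>simp_all add: P_def\<close>)
    show "\<sigma> (j + n) \<le> W * (1 + \<alpha>) ^ n * \<sigma> j"
      if "\<And>i. i \<le> n \<Longrightarrow> updated \<alpha> (M (j + i)) (P (j + i)) \<and> \<not> updated \<alpha> (P (j + i)) (M (j + i))" for j n
      unfolding \<sigma>_def max.commute[of "\<bar>P _\<bar>"] M_def W_def
      by (rule M.growth_only_updated) (use that \<alpha> in \<open>simp_all add: M_def\<close>)
    show "\<sigma> (Suc i) \<le> (1 + 1 / \<alpha>) * \<sigma> i" for i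
    proof -
      have "\<bar>P (Suc i)\<bar> \<le> (1 + 1 / \<alpha>) * \<sigma> i"
        unfolding \<sigma>_def P_def by (rule P.growth_Suc[OF tp rp])
      moreover have "\<bar>M (Suc i)\<bar> \<le> (1 + 1 / \<alpha>) * \<sigma> i"
        unfolding \<sigma>_def max.commute[of "\<bar>P _\<bar>"] M_def by (rule M.growth_Suc[OF tp rp])
      ultimately show ?thesis unfolding \<sigma>_def[of "Suc i"] by (rule max.boundedI)
    qed
    show "updated \<alpha> (P i) (M i) \<or> updated \<alpha> (M i) (P i)" if "0 < \<sigma> i" for i
      using updated_or_updated[OF \<alpha>] that by (simp add: \<sigma>_def)
  qed (use x y lx \<alpha> in \<open>auto simp: D_def W_def \<sigma>_def\<close>)
  \<comment> \<open>On \<open>{0..pi}\<close> times \<open>{0..1}\<close>, the values at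
    \<open>t\<close> and \<open>t - pi\<close> are half the sum and half the difference of the
    parity parts. The symmetry carries the bound to negative radii.\<close>
  have cover: "\<bar>e k t r\<bar> \<le> \<sigma> k" if "t \<in> {-pi..pi}" "r \<in> {-1..1}" for k t r
  proof -
    have le: "\<bar>e k t r\<bar> \<le> \<sigma> k" "\<bar>e k (t - pi) r\<bar> \<le> \<sigma> k" if "t \<in> {0..pi}" "r \<in> {0..1}" for t r
      using le_\<sigma>[OF that, of k] by (auto simp: p_def m_def even_part_def odd_part_def)
    have sym_k: "e k t (- r) = e k (t - pi) r" "e k (t - pi) (- r) = e k t r"
      if "t \<in> {0..pi}" "r \<in> {0..1}" for t r
      using sym[of k] that by (auto simp: bmc_symmetric_def)
    show ?thesis
      using le[of t r] le[of "t + pi" r] le[of t "- r"] le[of "t + pi" "- r"]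
        sym_k[of t "- r"] sym_k[of "t + pi" "- r"] that
      by (cases "0 \<le> t"; cases "0 \<le> r") auto
  qed
  have y_k: "y ^ k = \<mu> powr (- real k)" for k
    using \<mu> by (simp add: y_def powr_minus powr_realpow power_one_over inverse_eq_divide)
  \<comment> \<open>Adding 1 makes the constant strictly positive even when
    \<open>D = 0\<close>.\<close>
  have "\<bar>e k t r\<bar> \<le> (\<bar>C\<bar> + 1) * \<mu> powr (- real k)" if "t \<in> {-pi..pi}" "r \<in> {-1..1}" for k t r
  proof -
    have "C * \<mu> powr (- real k) \<le> (\<bar>C\<bar> + 1) * \<mu> powr (- real k)"
      by (intro mult_right_mono) auto
    then show ?thesis using cover[OF that, of k] rate[of k] unfolding y_k by linarith
  qed
  then show ?thesis
    unfolding \<mu>_def by (intro exI[of _ "\<bar>C\<bar> + 1"]) auto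
qed

end
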